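(* Let $k$ be an algebraically closed field, let $X=\{x_1,\ldots,x_\mu\}$ be a finite set of noncommuting variables, and let $M$ and $N$ be finite-dimensional (over $k$) semi-simple right $k\langle X\rangle$-modules. Then $M$ and $N$ are isomorphic as $k\langle X\rangle$-modules if and only if their characteristic functions coincide, i.e. $\chi_M=\chi_N$ in $k\langle\langle X\rangle\rangle$.
   Context: $k\langle X\rangle$ is the free associative unital $k$-algebra (noncommutative polynomials) on $X=\{x_1,\ldots,x_\mu\}$, and $k\langle\langle X\rangle\rangle$ is the $k$-algebra of noncommutative formal power series in $x_1,\ldots,x_\mu$. $X^*$ is the free monoid on $X$; its elements are called words. For a right $k\langle X\rangle$-module $M$, finite-dimensional over $k$, let $u_i\in\mathrm{End}_k(M)$ be the endomorphism given by the action of $x_i$, and let $\alpha:k\langle X\rangle\to\mathrm{End}_k(M)$ be the $k$-algebra homomorphism with $\alpha(x_i)=u_i$ (endomorphisms are written on the right of their arguments, so $\alpha(x_{i_1}\cdots x_{i_p})$ means: apply $u_{i_1}$ first, then $u_{i_2}$, etc.). The characteristic function of $M$ is $$\chi_M=\sum_{w\in X^*}\mathrm{Tr}(\alpha(w))\,w\in k\langle\langle X\rangle\rangle .$$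
   Formalization: The field k is additionally assumed to have characteristic 0; in characteristic p the claim fails, since for simple S the modules S and S^(p+1) have equal characteristic functions but are not isomorphic. X is taken nonempty. *)

theory Defs
  imports "HOL-Library.Poly_Mapping" "HOL-Computational_Algebra.Computational_Algebra"
begin

text \<open>The free monoid \<open>X\<^sup>*\<close> on the letters of type \<open>'x\<close>. It is written additively only because
  the convolution product of \<^theory>\<open>HOL-Library.Poly_Mapping\<close> expects a (possibly
  noncommutative) additive monoid of exponents; the addition is concatenation of words.\<close>

datatype 'x free_monoid = Word (letters: "'x list")

instantiation free_monoid :: (type) monoid_add
begin

definition "0 = Word []"
definition "v + w = Word (letters v @ letters w)"

instance
  by standard (simp_all add: zero_free_monoid_def plus_free_monoid_def)

end

text \<open>The free algebra \<open>k\<langle>X\<rangle>\<close>: finitely supported functions on words, with convolution.\<close>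

type_synonym ('x, 'k) free_algebra = "'x free_monoid \<Rightarrow>\<^sub>0 'k"

definition var :: "'x \<Rightarrow> ('x, 'k::field) free_algebra" where
  "var i = Poly_Mapping.single (Word [i]) 1"

definition monomial :: "'x free_monoid \<Rightarrow> ('x, 'k::field) free_algebra" where
  "monomial w = Poly_Mapping.single w 1"

definition const :: "'k::field \<Rightarrow> ('x, 'k) free_algebra" where
  "const c = Poly_Mapping.single 0 c"

text \<open>Elements of \<open>k\<langle>\<langle>X\<rangle>\<rangle>\<close> are represented by their coefficient families.\<close>

type_synonym ('x, 'k) nc_series = "'x free_monoid \<Rightarrow> 'k"

locale right_module =
  fixes act :: "'m::ab_group_add \<Rightarrow> 'r::ring_1 \<Rightarrow> 'm" (infixl \<open>\<lhd>\<close> 75)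
  assumes act_add_left: "(m + n) \<lhd> a = m \<lhd> a + n \<lhd> a"
    and act_add_right: "m \<lhd> (a + b) = m \<lhd> a + m \<lhd> b"
    and act_mult: "m \<lhd> (a * b) = (m \<lhd> a) \<lhd> b"
    and act_one: "m \<lhd> 1 = m"

definition submodule :: "('m::ab_group_add \<Rightarrow> 'r::ring_1 \<Rightarrow> 'm) \<Rightarrow> 'm set \<Rightarrow> bool" where
  "submodule act S \<longleftrightarrow>
     0 \<in> S \<and> (\<forall>m\<in>S. \<forall>n\<in>S. m + n \<in> S) \<and> (\<forall>m\<in>S. \<forall>a. act m a \<in> S)"

definition simple_submodule :: "('m::ab_group_add \<Rightarrow> 'r::ring_1 \<Rightarrow> 'm) \<Rightarrow> 'm set \<Rightarrow> bool" where
  "simple_submodule act S \<longleftrightarrow>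
     submodule act S \<and> S \<noteq> {0} \<and> (\<forall>T. submodule act T \<and> T \<subseteq> S \<longrightarrow> T = {0} \<or> T = S)"

text \<open>The module is the internal direct sum of the members of \<open>F\<close>. Indexing by the
  set \<open>F\<close> itself loses no generality for nonzero summands, since distinct nonzero summands of a
  direct sum are distinct as subsets.\<close>

definition internal_direct_sum :: "'m::ab_group_add set set \<Rightarrow> bool" where
  "internal_direct_sum F \<longleftrightarrow>
     (\<forall>m. \<exists>!f. (\<forall>S\<in>F. f S \<in> S) \<and> (\<forall>S. S \<notin> F \<longrightarrow> f S = 0) \<and>
              finite {S. f S \<noteq> 0} \<and> m = (\<Sum>S | f S \<noteq> 0. f S))"

definition semisimple :: "('m::ab_group_add \<Rightarrow> 'r::ring_1 \<Rightarrow> 'm) \<Rightarrow> bool" where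
  "semisimple act \<longleftrightarrow> (\<exists>F. (\<forall>S\<in>F. simple_submodule act S) \<and> internal_direct_sum F)"

definition isomorphic ::
  "('m::ab_group_add \<Rightarrow> 'r::ring_1 \<Rightarrow> 'm) \<Rightarrow> ('n::ab_group_add \<Rightarrow> 'r \<Rightarrow> 'n) \<Rightarrow> bool" where
  "isomorphic act act' \<longleftrightarrow>
     (\<exists>\<phi>. bij \<phi> \<and> (\<forall>m n. \<phi> (m + n) = \<phi> m + \<phi> n) \<and> (\<forall>m a. \<phi> (act m a) = act' (\<phi> m) a))"

definition scale ::
  "('m::ab_group_add \<Rightarrow> ('x, 'k::field) free_algebra \<Rightarrow> 'm) \<Rightarrow> 'k \<Rightarrow> 'm \<Rightarrow> 'm" where
  "scale act c m = act m (const c)"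

lemma const_add: "const (c + d) = const c + const d"
  by (simp add: const_def single_add)

lemma const_mult: "const (c * d) = const d * const c"
  by (simp add: const_def mult_single mult.commute)

lemma const_one: "const 1 = 1"
  by (simp add: const_def)

lemma vector_space_scale: "right_module act \<Longrightarrow> vector_space (scale act)"
  by unfold_locales
    (simp_all add: scale_def const_add const_one const_mult
      right_module.act_add_left right_module.act_add_right right_module.act_one
      flip: right_module.act_mult)

definition finite_dimensional ::
  "('m::ab_group_add \<Rightarrow> ('x, 'k::field) free_algebra \<Rightarrow> 'm) \<Rightarrow> bool" where
  "finite_dimensional act \<longleftrightarrow> (\<exists>B. finite B \<and> module.span (scale act) B = UNIV)"

text \<open>The trace over \<open>k\<close> of an endomorphism \<open>f\<close>: the sum of the diagonal entries of its matrix
  with respect to an arbitrarily chosen basis, on which it does not depend.\<close>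

definition endo_trace ::
  "('m::ab_group_add \<Rightarrow> ('x, 'k::field) free_algebra \<Rightarrow> 'm) \<Rightarrow> ('m \<Rightarrow> 'm) \<Rightarrow> 'k" where
  "endo_trace act f =
     (let B = (SOME B. \<not> module.dependent (scale act) B \<and> module.span (scale act) B = UNIV)
      in \<Sum>b\<in>B. module.representation (scale act) B (f b) b)"

definition alpha ::
  "('m::ab_group_add \<Rightarrow> ('x, 'k::field) free_algebra \<Rightarrow> 'm) \<Rightarrow> ('x, 'k) free_algebra \<Rightarrow> 'm \<Rightarrow> 'm" where
  "alpha act a = (\<lambda>m. act m a)"

definition char_fun ::
  "('m::ab_group_add \<Rightarrow> ('x, 'k::field) free_algebra \<Rightarrow> 'm) \<Rightarrow> ('x, 'k) nc_series" where
  "char_fun act = (\<lambda>w. endo_trace act (alpha act (monomial w)))"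

text \<open>On words, \<^const>\<open>alpha\<close> is the composite of the actions \<open>u\<^sub>i\<close> of the letters, the leftmost
  letter being applied first.\<close>

lemma alpha_word:
  fixes act :: "'m::ab_group_add \<Rightarrow> ('x, 'k::field) free_algebra \<Rightarrow> 'm"
  assumes "right_module act"
  shows "alpha act (monomial (Word is)) = fold (\<lambda>i. alpha act (var i)) is"
proof
  fix m
  interpret right_module act by fact
  show "alpha act (monomial (Word is)) m = fold (\<lambda>i. alpha act (var i)) is m"
  proof (induction "is" arbitrary: m)
    case Nil
    then show ?case
      by (simp add: alpha_def monomial_def act_one flip: zero_free_monoid_def)
  next
    case (Cons i "is")
    have "monomial (Word (i # is)) = var i * (monomial (Word is) :: ('x, 'k) free_algebra)"
      by (simp add: monomial_def var_def mult_single plus_free_monoid_def)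
    then show ?case
      using Cons by (simp add: alpha_def act_mult)
  qed
qed

end

theory Submission
  imports Defs "HOL-Library.Product_Plus"
begin

text \<open>If \<open>S\<close> is simple, some element of the free algebra acts as the identity on all summands of
  \<open>M\<close> and \<open>N\<close> isomorphic to \<open>S\<close> and as zero on all the others (a form of the density theorem,
  applied to the semisimple module \<open>M \<times> N\<close>). By linearity, equal characteristic functions give this
  element equal traces on \<open>M\<close> and \<open>N\<close>, and these traces are the multiplicity of \<open>S\<close> times its
  dimension; in characteristic zero the multiplicities are therefore equal.\<close>

text \<open>The hypothesis compares the traces of one and the same element on both modules, so
  elements found separately for \<open>M\<close> and for \<open>N\<close> would be useless; this is
  why density is applied inside a product. What density has to supply is modest: if the common
  annihilator of the unwanted summands kills no nonzero vector of a wanted one, it contains an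
  element fixing any given finite set of wanted vectors, and a basis is such a set. Characteristic
  zero cannot be dropped: in characteristic \<open>p\<close>, the sum of \<open>p\<close> copies of
  a finite-dimensional simple module has the same characteristic function as the zero module, namely
  zero. The summands of \<open>M\<close> and of \<open>N\<close> are subsets of different types.
  Multiplicities are therefore counted relative to a submodule of a third, arbitrary module, and in
  the end submodules of the product label the isomorphism classes.\<close>

context right_module
begin

section \<open>Elementary rules for right modules and submodules\<close>

lemma act_zero_left: "0 \<lhd> a = 0"
  using act_add_left[of 0 0 a] by simp

lemma act_zero_right: "m \<lhd> 0 = 0"
  using act_add_right[of m 0 0] by simp

lemma act_minus_left: "(- m) \<lhd> a = - (m \<lhd> a)"
  using act_add_left[of m "- m" a] by (simp add: act_zero_left eq_neg_iff_add_eq_0 add.commute)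

lemma act_minus_right: "m \<lhd> (- a) = - (m \<lhd> a)"
  using act_add_right[of m a "- a"] by (simp add: act_zero_right eq_neg_iff_add_eq_0 add.commute)

lemma act_diff_left: "(m - n) \<lhd> a = m \<lhd> a - n \<lhd> a"
  using act_add_left[of m "- n" a] by (simp add: act_minus_left)

lemma act_diff_right: "m \<lhd> (a - b) = m \<lhd> a - m \<lhd> b"
  using act_add_right[of m a "- b"] by (simp add: act_minus_right)

lemma act_sum_left: "(\<Sum>i\<in>I. f i) \<lhd> a = (\<Sum>i\<in>I. f i \<lhd> a)"
  by (induction I rule: infinite_finite_induct) (auto simp: act_zero_left act_add_left)

lemma act_sum_right: "m \<lhd> (\<Sum>i\<in>I. f i) = (\<Sum>i\<in>I. m \<lhd> f i)"
  by (induction I rule: infinite_finite_induct) (auto simp: act_zero_right act_add_right)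

lemma submodule_0: "submodule (\<lhd>) S \<Longrightarrow> 0 \<in> S"
  by (simp add: submodule_def)

lemma submodule_add: "submodule (\<lhd>) S \<Longrightarrow> x \<in> S \<Longrightarrow> y \<in> S \<Longrightarrow> x + y \<in> S"
  by (simp add: submodule_def)

lemma submodule_act: "submodule (\<lhd>) S \<Longrightarrow> x \<in> S \<Longrightarrow> x \<lhd> a \<in> S"
  by (simp add: submodule_def)

lemma submodule_minus: "submodule (\<lhd>) S \<Longrightarrow> x \<in> S \<Longrightarrow> - x \<in> S"
  using submodule_act[of S x "- 1"] by (simp add: act_minus_right act_one)

lemma submodule_diff: "submodule (\<lhd>) S \<Longrightarrow> x \<in> S \<Longrightarrow> y \<in> S \<Longrightarrow> x - y \<in> S"
  using submodule_add[of S x "- y"] by (simp add: submodule_minus)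

end

section \<open>Isomorphism between submodules of different modules\<close>

text \<open>The two ambient types may differ, so that summands of both modules and submodules of
  their product can be compared. The map is total, but only its values on \<open>S\<close>
  matter.\<close>

definition submodule_iso ::
  "('m::ab_group_add \<Rightarrow> 'r::ring_1 \<Rightarrow> 'm) \<Rightarrow> 'm set \<Rightarrow> ('n::ab_group_add \<Rightarrow> 'r \<Rightarrow> 'n) \<Rightarrow> 'n set \<Rightarrow> bool" where
  "submodule_iso act S act' T \<longleftrightarrow>
     (\<exists>\<phi>. bij_betw \<phi> S T \<and> (\<forall>x\<in>S. \<forall>y\<in>S. \<phi> (x + y) = \<phi> x + \<phi> y) \<and>
          (\<forall>x\<in>S. \<forall>a. \<phi> (act x a) = act' (\<phi> x) a))"

lemma submodule_iso_refl: "submodule_iso act S act S"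
  unfolding submodule_iso_def by (rule exI[of _ id]) auto

text \<open>Closure of \<open>S\<close> is what the inverse needs: \<open>inv_into\<close> undoes
  the map at \<open>x + y\<close> and at \<open>act x a\<close> only because these lie in
  \<open>S\<close> again.\<close>

lemma submodule_iso_sym:
  assumes "submodule act S" and "submodule_iso act S act' T"
  shows "submodule_iso act' T act S"
proof -
  obtain \<phi> where \<phi>: "bij_betw \<phi> S T" "\<And>x y. x \<in> S \<Longrightarrow> y \<in> S \<Longrightarrow> \<phi> (x + y) = \<phi> x + \<phi> y"
    "\<And>x a. x \<in> S \<Longrightarrow> \<phi> (act x a) = act' (\<phi> x) a"
    using assms(2) unfolding submodule_iso_def by blast
  let ?\<psi> = "inv_into S \<phi>"
  have \<psi>: "?\<psi> (\<phi> x) = x" if "x \<in> S" for x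
    using \<phi>(1) that by (meson bij_betw_inv_into_left)
  have img: "\<exists>x\<in>S. y = \<phi> x" if "y \<in> T" for y
    using \<phi>(1) that by (auto simp: bij_betw_def)
  have "?\<psi> (x + y) = ?\<psi> x + ?\<psi> y" if "x \<in> T" "y \<in> T" for x y
    using img[OF that(1)] img[OF that(2)] assms(1)
    by (auto simp: submodule_def \<psi> simp flip: \<phi>(2))
  moreover have "?\<psi> (act' x a) = act (?\<psi> x) a" if "x \<in> T" for x a
    using img[OF that(1)] assms(1) by (auto simp: submodule_def \<psi> simp flip: \<phi>(3))
  ultimately show ?thesis
    unfolding submodule_iso_def using bij_betw_inv_into[OF \<phi>(1)] by blast
qed

lemma submodule_iso_trans:
  assumes "submodule_iso act S act' T" and "submodule_iso act' T act'' U"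
  shows "submodule_iso act S act'' U"
proof -
  obtain \<phi> where \<phi>: "bij_betw \<phi> S T" "\<forall>x\<in>S. \<forall>y\<in>S. \<phi> (x + y) = \<phi> x + \<phi> y"
    "\<forall>x\<in>S. \<forall>a. \<phi> (act x a) = act' (\<phi> x) a"
    using assms(1) unfolding submodule_iso_def by blast
  obtain \<psi> where \<psi>: "bij_betw \<psi> T U" "\<forall>x\<in>T. \<forall>y\<in>T. \<psi> (x + y) = \<psi> x + \<psi> y"
    "\<forall>x\<in>T. \<forall>a. \<psi> (act' x a) = act'' (\<psi> x) a"
    using assms(2) unfolding submodule_iso_def by blast
  show ?thesis
    unfolding submodule_iso_def
    using \<phi> \<psi> bij_betw_trans[OF \<phi>(1) \<psi>(1)] bij_betwE[OF \<phi>(1)]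
    by (intro exI[of _ "\<psi> \<circ> \<phi>"]) auto
qed

section \<open>Annihilators of simple submodules and the separating element\<close>

context right_module
begin

text \<open>A right ideal \<open>L\<close> sends \<open>s\<close> onto a submodule of
  \<open>S\<close>, so by simplicity onto zero or everything. With \<open>L\<close> annihilating
  finitely many other vectors, \<open>s\<close> can be moved anywhere in \<open>S\<close> without
  disturbing those vectors' images.\<close>

lemma simple_submodule_eq_ideal_image:
  assumes S: "simple_submodule (\<lhd>) S" and s: "s \<in> S"
    and L: "0 \<in> L" "\<And>a b. a \<in> L \<Longrightarrow> b \<in> L \<Longrightarrow> a + b \<in> L" "\<And>a b. a \<in> L \<Longrightarrow> a * b \<in> L"
    and ne: "\<exists>a\<in>L. s \<lhd> a \<noteq> 0"
  shows "(\<lambda>a. s \<lhd> a) ` L = S"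
proof -
  have sub: "submodule (\<lhd>) S" using S by (simp add: simple_submodule_def)
  have "submodule (\<lhd>) ((\<lambda>a. s \<lhd> a) ` L)"
    unfolding submodule_def
  proof (intro conjI ballI allI)
    show "0 \<in> (\<lambda>a. s \<lhd> a) ` L"
      using L(1) act_zero_right[of s] by (metis imageI)
  qed (use L in \<open>auto simp flip: act_add_right act_mult\<close>)
  moreover have "(\<lambda>a. s \<lhd> a) ` L \<subseteq> S" using sub s by (auto simp: submodule_act)
  moreover have "(\<lambda>a. s \<lhd> a) ` L \<noteq> {0}" using ne by auto
  ultimately show ?thesis using S unfolding simple_submodule_def by blast
qed

text \<open>An annihilator of a nonzero element of a simple module is a maximal right ideal. If it contains
  a finite intersection of such ideals, delete terms until the inclusion breaks: the last deleted
  term then has the same simple quotient.\<close>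

lemma ann_subset_imp_iso:
  assumes "finite W" and W: "\<And>w. w \<in> W \<Longrightarrow> \<exists>T\<in>D. w \<in> T" and D: "\<And>T. T \<in> D \<Longrightarrow> simple_submodule (\<lhd>) T"
    and S: "simple_submodule (\<lhd>) S" and s: "s \<in> S" "s \<noteq> 0"
    and ann: "\<And>a. (\<And>w. w \<in> W \<Longrightarrow> w \<lhd> a = 0) \<Longrightarrow> s \<lhd> a = 0"
  shows "\<exists>T\<in>D. submodule_iso (\<lhd>) T (\<lhd>) S"
  using assms(1,2) ann
proof (induction W)
  case empty
  from empty.prems(2)[of 1] s(2) show ?case by (simp add: act_one)
next
  case (insert v W)
  show ?case
  proof (cases "\<forall>a. (\<forall>w\<in>W. w \<lhd> a = 0) \<longrightarrow> s \<lhd> a = 0")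
    case True
    with insert show ?thesis by simp
  next
    case False
    define L where "L = {a. \<forall>w\<in>W. w \<lhd> a = 0}"
    from False obtain a0 where a0: "a0 \<in> L" "s \<lhd> a0 \<noteq> 0" unfolding L_def by auto
    have L: "0 \<in> L" "\<And>a b. a \<in> L \<Longrightarrow> b \<in> L \<Longrightarrow> a + b \<in> L" "\<And>a b. a \<in> L \<Longrightarrow> a * b \<in> L"
      "\<And>a b. a \<in> L \<Longrightarrow> b \<in> L \<Longrightarrow> a - b \<in> L"
      by (simp_all add: L_def act_zero_right act_add_right act_diff_right act_mult act_zero_left)
    have key: "s \<lhd> a = 0" if "a \<in> L" "v \<lhd> a = 0" for a
      by (rule insert.prems(2)) (use that in \<open>auto simp: L_def\<close>)
    obtain T where T: "T \<in> D" "v \<in> T" using insert.prems(1) by blast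
    have simT: "simple_submodule (\<lhd>) T" using D T by simp
    \<comment> \<open>If \<open>v \<lhd> a0\<close> vanished, \<open>key\<close> would make
      \<open>s \<lhd> a0\<close> vanish as well; hence \<open>L\<close> does not kill
      \<open>v\<close>.\<close>
    have vL: "(\<lambda>a. v \<lhd> a) ` L = T"
      by (rule simple_submodule_eq_ideal_image[OF simT T(2) L(1-3)])
        (use a0 key[OF a0(1)] in auto)
    have sL: "(\<lambda>a. s \<lhd> a) ` L = S"
      by (rule simple_submodule_eq_ideal_image[OF S s(1)]) (use L a0 in auto)
    \<comment> \<open>The map sending \<open>v \<lhd> a\<close> to \<open>s \<lhd> a\<close> for
      \<open>a\<close> in \<open>L\<close>. The choice of \<open>a\<close> is harmless: two
      candidates differ by an element of \<open>L\<close> that kills \<open>v\<close>, hence also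
      \<open>s\<close> by \<open>key\<close>.\<close>
    define \<psi> where "\<psi> x = s \<lhd> (SOME a. a \<in> L \<and> v \<lhd> a = x)" for x
    have \<psi>: "\<psi> (v \<lhd> a) = s \<lhd> a" if a: "a \<in> L" for a
    proof -
      let ?b = "SOME b. b \<in> L \<and> v \<lhd> b = v \<lhd> a"
      have b: "?b \<in> L \<and> v \<lhd> ?b = v \<lhd> a"
        by (rule someI[of _ a]) (use a in simp)
      have "s \<lhd> (?b - a) = 0"
        by (rule key) (use a b L in \<open>auto simp: act_diff_right\<close>)
      then show ?thesis by (simp add: \<psi>_def act_diff_right)
    qed
    have add: "\<psi> (x + y) = \<psi> x + \<psi> y" if xy: "x \<in> T" "y \<in> T" for x y
    proof -
      obtain a b where ab: "x = v \<lhd> a" "y = v \<lhd> b" "a \<in> L" "b \<in> L" using xy vL by blast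
      show ?thesis using \<psi>[of "a + b"] ab L by (simp add: act_add_right \<psi>)
    qed
    have act: "\<psi> (x \<lhd> c) = \<psi> x \<lhd> c" if x: "x \<in> T" for x c
    proof -
      obtain a where a: "x = v \<lhd> a" "a \<in> L" using x vL by blast
      show ?thesis using \<psi>[of "a * c"] a L by (simp add: act_mult \<psi>)
    qed
    have Tsub: "submodule (\<lhd>) T" using simT by (simp add: simple_submodule_def)
    have \<psi>0: "\<psi> 0 = 0" using \<psi>[of 0] L by (simp add: act_zero_right)
    let ?K = "{x \<in> T. \<psi> x = 0}"
    have "submodule (\<lhd>) ?K"
      using Tsub by (auto simp: submodule_def add act \<psi>0 act_zero_left)
    moreover have "v \<lhd> a0 \<in> T" "\<psi> (v \<lhd> a0) \<noteq> 0" using a0 vL \<psi> by auto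
    then have "?K \<noteq> T" by blast
    ultimately have K: "?K = {0}" using simT unfolding simple_submodule_def by blast
    have "inj_on \<psi> T"
    proof (rule inj_onI)
      fix x y assume xy: "x \<in> T" "y \<in> T" "\<psi> x = \<psi> y"
      have "x - y \<in> T" using xy Tsub by (simp add: submodule_diff)
      moreover from add[OF this xy(2)] have "\<psi> (x - y) = 0" using xy by simp
      ultimately have "x - y \<in> ?K" by simp
      then show "x = y" using K by simp
    qed
    moreover have "\<psi> ` T = S" using vL sL \<psi> by (auto simp: image_iff)
    ultimately have "submodule_iso (\<lhd>) T (\<lhd>) S"
      unfolding submodule_iso_def bij_betw_def using add act by blast
    with T show ?thesis by blast
  qed
qed

text \<open>Given \<open>e\<close> fixing \<open>V\<close>, a further vector \<open>s\<close> is
  handled by adding a correction from the part \<open>L\<close> of \<open>J\<close> that kills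
  \<open>V\<close>. If \<open>L\<close> moves \<open>s\<close>, it moves \<open>s\<close> onto all
  of \<open>S\<close>, in particular onto the defect \<open>s - s \<lhd> e\<close>. If it does not,
  \<open>J\<close> kills the defect, which must then be zero.\<close>

lemma ideal_local_unit:
  assumes J: "0 \<in> J" "\<And>a b. a \<in> J \<Longrightarrow> b \<in> J \<Longrightarrow> a + b \<in> J"
      "\<And>a b. a \<in> J \<Longrightarrow> a * b \<in> J" "\<And>a b. a \<in> J \<Longrightarrow> b * a \<in> J"
    and "finite V"
    and V: "\<And>v. v \<in> V \<Longrightarrow> \<exists>S\<in>C. v \<in> S" and C: "\<And>S. S \<in> C \<Longrightarrow> simple_submodule (\<lhd>) S"
    and ne: "\<And>S x. S \<in> C \<Longrightarrow> x \<in> S \<Longrightarrow> x \<noteq> 0 \<Longrightarrow> \<exists>a\<in>J. x \<lhd> a \<noteq> 0"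
  shows "\<exists>e\<in>J. \<forall>v\<in>V. v \<lhd> e = v"
  using assms(5,6)
proof (induction V)
  case empty
  with J show ?case by auto
next
  case (insert s V)
  then obtain e where e: "e \<in> J" "\<And>v. v \<in> V \<Longrightarrow> v \<lhd> e = v" by auto
  obtain S where S: "S \<in> C" "s \<in> S" using insert.prems by blast
  have sub: "submodule (\<lhd>) S" using C[OF S(1)] by (simp add: simple_submodule_def)
  have Jm: "- a \<in> J" if "a \<in> J" for a using J(3)[OF that, of "- 1"] by simp
  have d: "s - s \<lhd> e \<in> S" using S sub by (simp add: submodule_diff submodule_act)
  define L where "L = {a \<in> J. \<forall>v\<in>V. v \<lhd> a = 0}"
  show ?case
  proof (cases "\<exists>a\<in>L. s \<lhd> a \<noteq> 0")
    case True
    have "(\<lambda>a. s \<lhd> a) ` L = S"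
      by (rule simple_submodule_eq_ideal_image[OF C[OF S(1)] S(2) _ _ _ True])
        (use J in \<open>auto simp: L_def act_zero_right act_add_right act_mult act_zero_left\<close>)
    with d obtain a where "a \<in> L" "s \<lhd> a = s - s \<lhd> e" by (metis imageE)
    then show ?thesis
      using e J by (intro bexI[of _ "e + a"]) (auto simp: act_add_right L_def)
  next
    case False
    have "(s - s \<lhd> e) \<lhd> a = 0" if a: "a \<in> J" for a
    proof -
      \<comment> \<open>On \<open>V\<close> the element \<open>e * a\<close> acts like
        \<open>a\<close>, because \<open>e\<close> acts first and fixes \<open>V\<close>.\<close>
      have "a - e * a \<in> L"
        using a e J Jm J(2)[of a "- (e * a)"]
        by (auto simp: L_def act_diff_right act_mult)
      then have "s \<lhd> (a - e * a) = 0" using False by blast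
      then show ?thesis by (simp add: act_diff_right act_diff_left act_mult)
    qed
    then have "s = s \<lhd> e" using ne[OF S(1) d] by auto
    then show ?thesis using e by (intro bexI[of _ e]) auto
  qed
qed

text \<open>Let \<open>J\<close> be the annihilator of \<open>\<Union>D\<close>. If \<open>J\<close>
  killed a nonzero vector of some \<open>S\<close> in \<open>C\<close>, the common annihilator of
  the finite set \<open>W\<close> would kill it too, which forces \<open>S\<close> to be isomorphic
  to a member of \<open>D\<close>. So \<open>J\<close> satisfies the nondegeneracy condition for
  local units. The role of \<open>W\<close> is to reduce annihilating \<open>\<Union>D\<close> to
  finitely many conditions.\<close>

lemma separating_element:
  assumes C: "\<And>S. S \<in> C \<Longrightarrow> simple_submodule (\<lhd>) S" and D: "\<And>T. T \<in> D \<Longrightarrow> simple_submodule (\<lhd>) T"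
    and not_iso: "\<And>S T. S \<in> C \<Longrightarrow> T \<in> D \<Longrightarrow> \<not> submodule_iso (\<lhd>) T (\<lhd>) S"
    and "finite V" "V \<subseteq> \<Union>C" and "finite W" "W \<subseteq> \<Union>D"
    and W: "\<And>a x. (\<And>w. w \<in> W \<Longrightarrow> w \<lhd> a = 0) \<Longrightarrow> x \<in> \<Union>D \<Longrightarrow> x \<lhd> a = 0"
  shows "\<exists>e. (\<forall>v\<in>V. v \<lhd> e = v) \<and> (\<forall>x\<in>\<Union>D. x \<lhd> e = 0)"
proof -
  define J where "J = {a. \<forall>x\<in>\<Union>D. x \<lhd> a = 0}"
  have Dsub: "x \<lhd> a \<in> \<Union>D" if "x \<in> \<Union>D" for x a
    using that D by (auto simp: simple_submodule_def intro: submodule_act)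
  have J: "0 \<in> J" "\<And>a b. a \<in> J \<Longrightarrow> b \<in> J \<Longrightarrow> a + b \<in> J"
      "\<And>a b. a \<in> J \<Longrightarrow> a * b \<in> J"
    by (auto simp: J_def act_zero_right act_zero_left act_add_right act_mult)
  have J': "b * a \<in> J" if "a \<in> J" for a b
    using that Dsub unfolding J_def mem_Collect_eq act_mult by blast
  have ne: "\<exists>a\<in>J. x \<lhd> a \<noteq> 0" if x: "S \<in> C" "x \<in> S" "x \<noteq> 0" for S x
  proof (rule ccontr)
    assume *: "\<not> (\<exists>a\<in>J. x \<lhd> a \<noteq> 0)"
    have "\<exists>T\<in>D. submodule_iso (\<lhd>) T (\<lhd>) S"
    proof (rule ann_subset_imp_iso[OF \<open>finite W\<close> _ D C x(2,3)])
      fix a assume "\<And>w. w \<in> W \<Longrightarrow> w \<lhd> a = 0"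
      then have "a \<in> J" using W unfolding J_def by blast
      then show "x \<lhd> a = 0" using * by blast
    qed (use assms x in auto)
    then show False using not_iso x by blast
  qed
  have "\<exists>e\<in>J. \<forall>v\<in>V. v \<lhd> e = v"
    by (rule ideal_local_unit[OF J J' \<open>finite V\<close> _ C ne]) (use assms in auto)
  then show ?thesis unfolding J_def by auto
qed

end

section \<open>Traces do not depend on the basis\<close>

context vector_space
begin

lemma representation_linear:
  assumes B: "finite B" "independent B" "span B = UNIV" and f: "Vector_Spaces.linear scale scale f"
    and C: "finite C" "independent C" "span C = UNIV"
  shows "representation B (f v) b = (\<Sum>c\<in>C. representation C v c * representation B (f c) b)"
proof -
  interpret f: Vector_Spaces.linear scale scale f by fact
  have "f v = f (\<Sum>c\<in>C. scale (representation C v c) c)"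
    using C by (simp add: sum_representation_eq)
  also have "\<dots> = (\<Sum>c\<in>C. scale (representation C v c) (f c))"
    by (simp add: f.sum f.scale)
  finally show ?thesis
    using B by (simp add: representation_sum representation_scale)
qed

text \<open>Two changes of basis and no inverse matrix: expand each \<open>b\<close> in
  \<open>C\<close>, swap the sums, and recognise the inner sum as the expansion in \<open>B\<close>
  of \<open>f c\<close>, read off in its \<open>C\<close>-coordinates. The second use of
  \<open>representation_linear\<close> is therefore for the identity map.\<close>

lemma trace_basis_independent:
  assumes B: "finite B" "independent B" "span B = UNIV" and f: "Vector_Spaces.linear scale scale f"
    and C: "finite C" "independent C" "span C = UNIV"
  shows "(\<Sum>b\<in>B. representation B (f b) b) = (\<Sum>c\<in>C. representation C (f c) c)"
proof -
  let ?B = "representation B" and ?C = "representation C"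
  have id: "Vector_Spaces.linear scale scale (\<lambda>v. v)" by (rule linear_ident)
  have "(\<Sum>b\<in>B. ?B (f b) b) = (\<Sum>b\<in>B. \<Sum>c\<in>C. ?C b c * ?B (f c) b)"
    by (intro sum.cong refl representation_linear[OF B f C])
  also have "\<dots> = (\<Sum>c\<in>C. \<Sum>b\<in>B. ?C b c * ?B (f c) b)"
    by (rule sum.swap)
  also have "\<dots> = (\<Sum>c\<in>C. ?C (f c) c)"
    by (intro sum.cong refl)
      (subst representation_linear[OF C id B], simp add: mult.commute)
  finally show ?thesis .
qed

end

section \<open>Modules over the free algebra as vector spaces, and the trace as a linear function of
  the acting element\<close>

locale free_algebra_module = right_module act
  for act :: "'m::ab_group_add \<Rightarrow> ('x, 'k::field) free_algebra \<Rightarrow> 'm" (infixl \<open>\<lhd>\<close> 75)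
begin

sublocale vector_space "scale (\<lhd>)"
  by (rule vector_space_scale) (rule right_module_axioms)

end

text \<open>Scalars act through \<open>const\<close>, so the centrality of constants is what makes
  the action of every element linear over the field.\<close>

lemma const_commute: "const c * a = a * const c" for a :: "('x, 'k::field) free_algebra"
proof (induction a rule: Poly_Mapping.update_induct)
  case const
  then show ?case by simp
next
  case (update f w d)
  have "Poly_Mapping.update w d f = f + Poly_Mapping.single w d"
    using update(1) by (intro poly_mapping_eqI) (auto simp: lookup_add lookup_single when_def in_keys_iff lookup_update)
  then show ?case
    using update by (simp add: algebra_simps const_def mult_single mult.commute)
qed

text \<open>The coefficient is a right factor because a right action applies that factor last, so it
  becomes a \<open>scale\<close> of the result of the word.\<close>

lemma free_algebra_expand:
  fixes a :: "('x, 'k::field) free_algebra"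
  shows "a = (\<Sum>w\<in>Poly_Mapping.keys a. monomial w * const (Poly_Mapping.lookup a w))"
proof (rule poly_mapping_eqI)
  fix v
  have "monomial w * const c = Poly_Mapping.single w c" for w :: "'x free_monoid" and c :: 'k
    by (simp add: monomial_def const_def mult_single)
  then have "Poly_Mapping.lookup (\<Sum>w\<in>Poly_Mapping.keys a. monomial w * const (Poly_Mapping.lookup a w)) v =
      (\<Sum>w\<in>Poly_Mapping.keys a. if w = v then Poly_Mapping.lookup a w else 0)"
    by (simp only: lookup_sum lookup_single when_def)
  also have "\<dots> = Poly_Mapping.lookup a v"
    by (simp add: sum.delta' in_keys_iff)
  finally show "Poly_Mapping.lookup a v =
      Poly_Mapping.lookup (\<Sum>w\<in>Poly_Mapping.keys a. monomial w * const (Poly_Mapping.lookup a w)) v" ..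
qed

context free_algebra_module
begin

lemma linear_act: "Vector_Spaces.linear (scale (\<lhd>)) (scale (\<lhd>)) (\<lambda>m. m \<lhd> a)"
proof -
  have "scale (\<lhd>) c m \<lhd> a = scale (\<lhd>) c (m \<lhd> a)" for c m
    unfolding scale_def by (metis act_mult const_commute)
  then show ?thesis
    unfolding Vector_Spaces.linear_iff using vector_space_axioms act_add_left by blast
qed

lemma submodule_imp_subspace: "submodule (\<lhd>) S \<Longrightarrow> subspace S"
  by (simp add: subspace_def submodule_def scale_def)

lemma finite_independent:
  assumes "finite_dimensional (\<lhd>)" "independent B"
  shows "finite B"
  using assms independent_span_bound unfolding finite_dimensional_def by blast

lemma endo_trace_eq:
  assumes "finite_dimensional (\<lhd>)" and B: "independent B" "span B = UNIV"
  shows "endo_trace (\<lhd>) (alpha (\<lhd>) a) = (\<Sum>b\<in>B. representation B (b \<lhd> a) b)"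
proof -
  define C where "C = (SOME C. independent C \<and> span C = UNIV)"
  have "independent C \<and> span C = UNIV"
    unfolding C_def by (rule someI[of _ B]) (use B in simp)
  then have "(\<Sum>c\<in>C. representation C (c \<lhd> a) c) = (\<Sum>b\<in>B. representation B (b \<lhd> a) b)"
    using B by (intro trace_basis_independent linear_act) (auto intro: finite_independent[OF assms(1)])
  then show ?thesis
    unfolding endo_trace_def Let_def C_def[symmetric] alpha_def .
qed

lemma finite_basis:
  assumes "finite_dimensional (\<lhd>)"
  obtains B where "finite B" "independent B" "span B = UNIV"
proof -
  obtain B where "independent B" "UNIV \<subseteq> span B"
    using maximal_independent_subset[of UNIV] by metis
  then show thesis using that finite_independent[OF assms] by blast
qed

text \<open>The trace is linear in the acting element, so its values on words determine it
  everywhere. This carries the hypothesis from words to the separating element, which is in general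
  no word.\<close>

lemma endo_trace_eq_char_fun_sum:
  assumes "finite_dimensional (\<lhd>)"
  shows "endo_trace (\<lhd>) (alpha (\<lhd>) a) =
    (\<Sum>w\<in>Poly_Mapping.keys a. Poly_Mapping.lookup a w * char_fun (\<lhd>) w)"
proof -
  obtain B where B: "finite B" "independent B" "span B = UNIV"
    using finite_basis[OF assms] .
  have "b \<lhd> a = (\<Sum>w\<in>Poly_Mapping.keys a. scale (\<lhd>) (Poly_Mapping.lookup a w) (b \<lhd> monomial w))" for b
    by (subst (1) free_algebra_expand[of a]) (simp add: act_sum_right act_mult scale_def)
  then have "endo_trace (\<lhd>) (alpha (\<lhd>) a) =
      (\<Sum>b\<in>B. \<Sum>w\<in>Poly_Mapping.keys a. Poly_Mapping.lookup a w * representation B (b \<lhd> monomial w) b)"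
    using B by (simp add: endo_trace_eq[OF assms B(2,3)] representation_sum representation_scale)
  also have "\<dots> = (\<Sum>w\<in>Poly_Mapping.keys a. Poly_Mapping.lookup a w * char_fun (\<lhd>) w)"
    by (subst sum.swap) (simp add: char_fun_def endo_trace_eq[OF assms B(2,3)] sum_distrib_left)
  finally show ?thesis .
qed

end

section \<open>Isomorphic modules have equal characteristic functions\<close>

text \<open>The isomorphism carries a basis of one module to a basis of the other, and in these two
  bases every word acts by the same matrix.\<close>

lemma char_fun_eq_if_isomorphic:
  assumes "free_algebra_module actM" and fM: "finite_dimensional actM"
    and "free_algebra_module actN" and fN: "finite_dimensional actN"
    and iso: "isomorphic actM actN"
  shows "char_fun actM = char_fun actN"
proof
  fix w
  interpret M: free_algebra_module actM by fact
  interpret N: free_algebra_module actN by fact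
  obtain \<phi> where \<phi>: "bij \<phi>" "\<And>m n. \<phi> (m + n) = \<phi> m + \<phi> n" "\<And>m a. \<phi> (actM m a) = actN (\<phi> m) a"
    using iso unfolding isomorphic_def by blast
  interpret vector_space_pair "scale actM" "scale actN" ..
  \<comment> \<open>Homogeneity is a case of equivariance, since scaling is the action of a
    constant.\<close>
  interpret \<phi>: Vector_Spaces.linear "scale actM" "scale actN" \<phi>
    unfolding Vector_Spaces.linear_iff using \<phi> M.vector_space_axioms N.vector_space_axioms by (simp add: scale_def)
  have inj: "inj \<phi>" using \<phi>(1) by (rule bij_is_inj)
  obtain B where B: "finite B" "M.independent B" "M.span B = UNIV"
    using M.finite_basis[OF fM] .
  have C: "N.independent (\<phi> ` B)" "N.span (\<phi> ` B) = UNIV"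
    using B \<phi>(1) \<phi>.linear_axioms inj
    by (auto simp: linear_independent_injective_image linear_span_image bij_is_surj)
  have rep: "N.representation (\<phi> ` B) (\<phi> m) (\<phi> b) = M.representation B m b" if "b \<in> B" for m b
  proof -
    have "\<phi> m = (\<Sum>b\<in>B. scale actN (M.representation B m b) (\<phi> b))"
      using B M.sum_representation_eq[of B m B] by (metis (no_types, lifting) UNIV_I \<phi>.scale \<phi>.sum order_refl sum.cong)
    then have "N.representation (\<phi> ` B) (\<phi> m) (\<phi> b) =
        (\<Sum>c\<in>B. M.representation B m c * (if \<phi> b = \<phi> c then 1 else 0))"
      using C by (simp add: N.representation_sum N.representation_scale N.representation_basis)
    also have "\<dots> = (\<Sum>c\<in>B. if b = c then M.representation B m c else 0)"
      using inj by (intro sum.cong) (auto simp: inj_def)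
    finally show ?thesis using B(1) that by simp
  qed
  have "char_fun actN w = (\<Sum>c\<in>\<phi> ` B. N.representation (\<phi> ` B) (actN c (monomial w)) c)"
    by (simp add: char_fun_def N.endo_trace_eq[OF fN C])
  also have "\<dots> = (\<Sum>b\<in>B. N.representation (\<phi> ` B) (\<phi> (actM b (monomial w))) (\<phi> b))"
    using inj by (subst sum.reindex) (auto simp: inj_on_def inj_def \<phi>(3))
  also have "\<dots> = char_fun actM w"
    by (simp add: rep char_fun_def M.endo_trace_eq[OF fM B(2,3)])
  finally show "char_fun actM w = char_fun actN w" by simp
qed

section \<open>Internal direct sums and bases adapted to them\<close>

text \<open>Extended by zero, \<open>f\<close> is a decomposition of \<open>0\<close>, and so is the
  zero family; uniqueness identifies them.\<close>

lemma internal_direct_sum_zeroD: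
  assumes F: "internal_direct_sum F" and F0: "\<And>S. S \<in> F \<Longrightarrow> 0 \<in> S"
    and F': "finite F'" "F' \<subseteq> F" and f: "\<And>S. S \<in> F' \<Longrightarrow> f S \<in> S"
    and sum: "(\<Sum>S\<in>F'. f S) = 0" and S: "S \<in> F'"
  shows "f S = 0"
proof -
  define g where "g S = (if S \<in> F' then f S else 0)" for S
  define P where "P m f \<longleftrightarrow> (\<forall>S\<in>F. f S \<in> S) \<and> (\<forall>S. S \<notin> F \<longrightarrow> f S = 0) \<and>
              finite {S. f S \<noteq> 0} \<and> m = (\<Sum>S | f S \<noteq> 0. f S)" for m f
  have fin: "{S. g S \<noteq> 0} \<subseteq> F'" by (auto simp: g_def)
  have "(\<Sum>S | g S \<noteq> 0. g S) = (\<Sum>S\<in>F'. g S)"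
    by (rule sum.mono_neutral_left) (use F' fin in auto)
  also have "\<dots> = 0" using sum by (simp add: g_def)
  finally have "P 0 g"
    using F' f F0 finite_subset[OF fin F'(1)] by (auto simp: g_def P_def)
  moreover have "P 0 (\<lambda>_. 0)" using F0 by (simp add: P_def)
  moreover have "\<exists>!f. P 0 f" using F unfolding internal_direct_sum_def P_def by (rule spec)
  ultimately have "g = (\<lambda>_. 0)" by blast
  then have "g S = 0" by simp
  then show ?thesis using S by (simp add: g_def)
qed

lemma internal_direct_sum_components:
  assumes "internal_direct_sum F"
  obtains F' f where "finite F'" "F' \<subseteq> F" "\<And>S. S \<in> F' \<Longrightarrow> f S \<in> S" "m = (\<Sum>S\<in>F'. f S)"
proof -
  obtain f where f: "\<forall>S\<in>F. f S \<in> S" "\<forall>S. S \<notin> F \<longrightarrow> f S = 0"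
      "finite {S. f S \<noteq> 0}" "m = (\<Sum>S | f S \<noteq> 0. f S)"
    using assms unfolding internal_direct_sum_def by metis
  show thesis
    by (rule that[of "{S. f S \<noteq> 0}" f]) (use f in auto)
qed

context free_algebra_module
begin

text \<open>Uniqueness of decompositions gives disjointness and independence, existence gives
  spanning. Disjointness is needed again when basis vectors are counted summand by summand.\<close>

lemma adapted_basis:
  assumes F: "internal_direct_sum F" and simp: "\<And>S. S \<in> F \<Longrightarrow> simple_submodule (\<lhd>) S"
    and basis: "\<And>S. S \<in> F \<Longrightarrow> independent (B S)" "\<And>S. S \<in> F \<Longrightarrow> span (B S) = S"
  shows "independent (\<Union>S\<in>F. B S)" and "span (\<Union>S\<in>F. B S) = UNIV"
    and "\<And>S T. S \<in> F \<Longrightarrow> T \<in> F \<Longrightarrow> S \<noteq> T \<Longrightarrow> B S \<inter> B T = {}"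
proof -
  have sub: "submodule (\<lhd>) S" if "S \<in> F" for S using simp[OF that] by (simp add: simple_submodule_def)
  have subsp: "subspace S" if "S \<in> F" for S using sub[OF that] by (rule submodule_imp_subspace)
  have BS: "B S \<subseteq> S" if "S \<in> F" for S using span_superset[of "B S"] basis(2)[OF that] by simp
  note zeroD = internal_direct_sum_zeroD[OF F submodule_0[OF sub]]
  show disj: "B S \<inter> B T = {}" if ST: "S \<in> F" "T \<in> F" "S \<noteq> T" for S T
  proof (rule equals0I)
    fix b assume b: "b \<in> B S \<inter> B T"
    have "b = 0"
    proof -
      \<comment> \<open>A common vector \<open>b\<close> yields the decomposition of
        \<open>0\<close> with component \<open>b\<close> in \<open>S\<close> and \<open>- b\<close>
        in \<open>T\<close>.\<close>
      let ?f = "\<lambda>U. if U = S then b else - b"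
      have "b \<in> S" "- b \<in> T" using ST b BS sub by (blast intro: submodule_minus)+
      then have "?f U \<in> U" if "U \<in> {S, T}" for U using that ST by auto
      from zeroD[of "{S, T}" ?f S, OF _ _ _ this] ST show ?thesis by simp
    qed
    then show False using b basis(1)[OF ST(1)] dependent_zero by blast
  qed
  show "independent (\<Union>S\<in>F. B S)"
    unfolding independent_explicit_module
  proof (intro allI impI)
    fix t u v assume t: "finite t" "t \<subseteq> (\<Union>S\<in>F. B S)"
      and s0: "(\<Sum>v\<in>t. scale (\<lhd>) (u v) v) = 0" and v: "v \<in> t"
    \<comment> \<open>\<open>h\<close> assigns to each basis vector its summand. Grouping a
      vanishing combination by \<open>h\<close> gives one component per summand; each component
      vanishes, and then independence inside a single \<open>B S\<close> applies.\<close>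
    define h where "h b = (SOME S. S \<in> F \<and> b \<in> B S)" for b
    have h: "h b \<in> F \<and> b \<in> B (h b)" if "b \<in> t" for b
      unfolding h_def by (rule someI_ex) (use t that in blast)
    have fib: "{b \<in> t. h b = S} = t \<inter> B S" if "S \<in> h ` t" for S
      using that h disj by blast
    have "(\<Sum>S\<in>h ` t. \<Sum>b | b \<in> t \<and> h b = S. scale (\<lhd>) (u b) b) = 0"
      using sum.image_gen[OF t(1), of "\<lambda>b. scale (\<lhd>) (u b) b" h] s0 by simp
    moreover have "(\<Sum>b | b \<in> t \<and> h b = S. scale (\<lhd>) (u b) b) \<in> S" if "S \<in> h ` t" for S
      using that h BS subsp by (intro subspace_sum subspace_scale) blast+
    ultimately have "(\<Sum>b | b \<in> t \<and> h b = h v. scale (\<lhd>) (u b) b) = 0"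
      using zeroD[of "h ` t" "\<lambda>S. \<Sum>b | b \<in> t \<and> h b = S. scale (\<lhd>) (u b) b" "h v"] v h t(1)
      by blast
    moreover have "{b \<in> t. h b = h v} \<subseteq> B (h v)" using fib v by blast
    ultimately show "u v = 0"
      using independentD[OF basis(1), of "h v" "{b \<in> t. h b = h v}" u v] t(1) v h by simp
  qed
  have "m \<in> span (\<Union>S\<in>F. B S)" for m
  proof -
    obtain F' f where f: "finite F'" "F' \<subseteq> F" "\<And>S. S \<in> F' \<Longrightarrow> f S \<in> S" "m = (\<Sum>S\<in>F'. f S)"
      using internal_direct_sum_components[OF F] by blast
    have "f S \<in> span (\<Union>S\<in>F. B S)" if "S \<in> F'" for S
      using f(2,3) that basis(2)[of S] span_mono[of "B S" "\<Union>S\<in>F. B S"] by blast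
    then show ?thesis unfolding f(4) by (rule span_sum)
  qed
  then show "span (\<Union>S\<in>F. B S) = UNIV" by auto
qed

lemma subspace_basis:
  assumes "subspace S"
  shows "\<exists>B. independent B \<and> span B = S"
  using basis_exists[of S] span_subspace[OF _ _ assms] by metis

text \<open>The bases of all summands unite to an independent, hence finite set, so only finitely
  many sets take part in the union; and each summand is recovered from its basis as the
  span.\<close>

lemma finite_summands:
  assumes "finite_dimensional (\<lhd>)" and F: "internal_direct_sum F"
    and simp: "\<And>S. S \<in> F \<Longrightarrow> simple_submodule (\<lhd>) S"
  shows "finite F"
proof -
  have "\<forall>S\<in>F. \<exists>B. independent B \<and> span B = S"
    using simp by (auto simp: simple_submodule_def intro: subspace_basis submodule_imp_subspace)
  then obtain B where "\<forall>S\<in>F. independent (B S) \<and> span (B S) = S"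
    by (rule bchoice[THEN exE])
  then have basis: "\<And>S. S \<in> F \<Longrightarrow> independent (B S)" "\<And>S. S \<in> F \<Longrightarrow> span (B S) = S"
    by simp_all
  have "finite (\<Union>(B ` F))"
    by (rule finite_independent[OF assms(1) adapted_basis(1)[OF F simp basis]])
  then have "finite (B ` F)" by (rule finite_UnionD)
  moreover have "inj_on B F" by (metis inj_onI basis(2))
  ultimately show ?thesis by (rule finite_imageD)
qed

text \<open>In the adapted basis \<open>e\<close> is diagonal, with entry one on the vectors
  belonging to \<open>C\<close> and zero on the others, so the trace counts the former.\<close>

lemma endo_trace_projection:
  assumes "finite_dimensional (\<lhd>)" and F: "internal_direct_sum F"
    and simp: "\<And>S. S \<in> F \<Longrightarrow> simple_submodule (\<lhd>) S"
    and basis: "\<And>S. S \<in> F \<Longrightarrow> independent (B S)" "\<And>S. S \<in> F \<Longrightarrow> span (B S) = S"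
    and C: "C \<subseteq> F" and e1: "\<And>b. b \<in> \<Union>(B ` C) \<Longrightarrow> b \<lhd> e = b"
    and e0: "\<And>b. b \<in> \<Union>(B ` (F - C)) \<Longrightarrow> b \<lhd> e = 0"
  shows "endo_trace (\<lhd>) (alpha (\<lhd>) e) = of_nat (\<Sum>S\<in>C. card (B S))"
proof -
  note ad = adapted_basis[OF F simp basis]
  have finF: "finite F" by (rule finite_summands[OF assms(1) F simp])
  let ?B = "\<Union>(B ` F)"
  have finB: "finite ?B" by (rule finite_independent[OF assms(1) ad(1)])
  have "endo_trace (\<lhd>) (alpha (\<lhd>) e) = (\<Sum>b\<in>?B. representation ?B (b \<lhd> e) b)"
    by (rule endo_trace_eq[OF assms(1) ad(1,2)])
  also have "\<dots> = (\<Sum>b\<in>\<Union>(B ` C). representation ?B (b \<lhd> e) b)"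
  proof (rule sum.mono_neutral_right[OF finB])
    have "b \<lhd> e = 0" if "b \<in> ?B - \<Union>(B ` C)" for b using that by (intro e0) blast
    then show "\<forall>b\<in>?B - \<Union>(B ` C). representation ?B (b \<lhd> e) b = 0"
      by (simp add: representation_zero)
  qed (use C in blast)
  also have "\<dots> = (\<Sum>b\<in>\<Union>(B ` C). 1)"
  proof (rule sum.cong)
    fix b assume b: "b \<in> \<Union>(B ` C)"
    then have "b \<in> ?B" using C by blast
    from representation_basis[OF ad(1) this] show "representation ?B (b \<lhd> e) b = 1"
      by (simp add: e1[OF b])
  qed simp
  also have "\<dots> = of_nat (card (\<Union>(B ` C)))" by simp
  also have "card (\<Union>(B ` C)) = (\<Sum>S\<in>C. card (B S))"
  proof (rule card_UN_disjoint)
    show "finite C" using C finF by (rule finite_subset)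
    show "\<forall>S\<in>C. finite (B S)" using C finB by (auto intro: finite_subset)
    show "\<forall>S\<in>C. \<forall>T\<in>C. S \<noteq> T \<longrightarrow> B S \<inter> B T = {}" using C ad(3) by blast
  qed
  finally show ?thesis .
qed

end

section \<open>Dimensions and isomorphism classes of submodules\<close>

text \<open>The image of \<open>B\<close> is independent and lies in the span of \<open>C\<close>,
  so the exchange bound applies. Used in both directions, this shows that isomorphic submodules have
  equal dimension.\<close>

lemma card_basis_le_if_iso:
  assumes "free_algebra_module actM" and "free_algebra_module actN"
    and S: "submodule actM S" and iso: "submodule_iso actM S actN T"
    and B: "\<not> module.dependent (scale actM) B" "B \<subseteq> S"
    and C: "finite C" "T \<subseteq> module.span (scale actN) C"
  shows "card B \<le> card C"
proof -
  interpret M: free_algebra_module actM by fact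
  interpret N: free_algebra_module actN by fact
  obtain \<phi> where \<phi>: "bij_betw \<phi> S T" "\<And>x y. x \<in> S \<Longrightarrow> y \<in> S \<Longrightarrow> \<phi> (x + y) = \<phi> x + \<phi> y"
    "\<And>x a. x \<in> S \<Longrightarrow> \<phi> (actM x a) = actN (\<phi> x) a"
    using iso unfolding submodule_iso_def by blast
  have inj: "inj_on \<phi> S" using \<phi>(1) by (rule bij_betw_imp_inj_on)
  have S0: "0 \<in> S" using S by (rule M.submodule_0)
  have \<phi>0: "\<phi> 0 = 0" using \<phi>(2)[OF S0 S0] by simp
  have subsp: "M.subspace S" using S by (rule M.submodule_imp_subspace)
  \<comment> \<open>Nothing is known about \<open>\<phi>\<close> outside \<open>S\<close>, so it is
    not a linear map of the whole space; linearity is proved for combinations whose partial sums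
    stay in \<open>S\<close>.\<close>
  have lin: "(\<Sum>b\<in>t. scale actN (u b) (\<phi> b)) = \<phi> (\<Sum>b\<in>t. scale actM (u b) b)" if "t \<subseteq> B" for t u
    using that
  proof (induction t rule: infinite_finite_induct)
    case (insert b t)
    have "(\<Sum>b\<in>t. scale actM (u b) b) \<in> S" "scale actM (u b) b \<in> S" "b \<in> S"
      using insert.prems B(2) subsp by (auto intro!: M.subspace_sum M.subspace_scale)
    with insert show ?case by (simp add: \<phi>(2)) (simp add: scale_def \<phi>(3))
  qed (simp_all add: \<phi>0)
  have injB: "inj_on \<phi> B" using inj B(2) by (rule inj_on_subset)
  have "N.independent (\<phi> ` B)"
    unfolding N.independent_explicit_module
  proof (intro allI impI)
    fix t u y assume t: "finite t" "t \<subseteq> \<phi> ` B" "(\<Sum>v\<in>t. scale actN (u v) v) = 0" "y \<in> t"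
    obtain t' where t': "t' \<subseteq> B" "t = \<phi> ` t'" using t(2) by (metis subset_image_iff)
    have inj': "inj_on \<phi> t'" using injB t'(1) by (rule inj_on_subset)
    have "\<phi> (\<Sum>b\<in>t'. scale actM (u (\<phi> b)) b) = \<phi> 0"
      using t(3) by (simp add: t'(2) sum.reindex[OF inj'] lin[OF t'(1), of "\<lambda>b. u (\<phi> b)"] \<phi>0)
    moreover have "(\<Sum>b\<in>t'. scale actM (u (\<phi> b)) b) \<in> S"
      using t'(1) B(2) subsp by (auto intro!: M.subspace_sum M.subspace_scale)
    ultimately have "(\<Sum>b\<in>t'. scale actM (u (\<phi> b)) b) = 0"
      using inj S0 by (auto dest: inj_onD)
    moreover obtain b where b: "b \<in> t'" "y = \<phi> b" using t(4) t'(2) by blast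
    moreover have "finite t'" using t(1) t'(2) inj' by (auto dest: finite_imageD)
    ultimately show "u y = 0"
      using M.independentD[OF B(1) _ t'(1), of "\<lambda>b. u (\<phi> b)" b] by simp
  qed
  moreover have "\<phi> ` B \<subseteq> N.span C"
    using B(2) C(2) bij_betw_imp_surj_on[OF \<phi>(1)] by blast
  ultimately have "card (\<phi> ` B) \<le> card C" using C(1) N.independent_span_bound by blast
  then show ?thesis by (simp add: card_image[OF injB])
qed

text \<open>If two naturals have the same image, the characteristic divides their difference; zero
  divides only zero.\<close>

lemma of_nat_inject_CHAR_0:
  assumes "CHAR('a::ring_1) = 0" and eq: "(of_nat m :: 'a) = of_nat n"
  shows "m = n"
proof -
  have le: "j \<le> i" if "(of_nat i :: 'a) = of_nat j" for i j
  proof (rule ccontr)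
    assume "\<not> j \<le> i"
    then have "(of_nat (j - i) :: 'a) = 0" using that by (simp add: of_nat_diff)
    then have "CHAR('a) dvd j - i" by (simp only: of_nat_eq_0_iff_char_dvd)
    then show False using assms(1) \<open>\<not> j \<le> i\<close> by simp
  qed
  show ?thesis using le[OF eq] le[OF eq[symmetric]] by simp
qed

lemma submodule_iso_common:
  "submodule_iso act S act0 U \<Longrightarrow> submodule_iso act' T act0 U \<Longrightarrow> submodule act' T \<Longrightarrow>
    submodule_iso act S act' T"
  using submodule_iso_trans submodule_iso_sym by blast

text \<open>An isomorphism class is encoded as the set of its representatives among the submodules
  of one reference module. Summands on different types thereby receive labels in a common type, and
  equality of labels means isomorphism.\<close>

lemma iso_class_eq_iff:
  assumes "submodule act S" and "submodule act' U"
  shows "{U'. submodule act' U' \<and> submodule_iso act S act' U'} =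
      {U'. submodule act' U' \<and> submodule_iso act' U act' U'} \<longleftrightarrow> submodule_iso act S act' U"
    (is "?K = ?L \<longleftrightarrow> ?iso")
proof
  assume "?K = ?L"
  then show ?iso using assms(2) submodule_iso_refl[of act' U] by blast
next
  assume iso: ?iso
  show "?K = ?L"
    using submodule_iso_trans[OF iso] submodule_iso_trans[OF submodule_iso_sym[OF assms(1) iso]] by blast
qed

context free_algebra_module
begin

lemma act_zero_on_span:
  assumes "\<And>b. b \<in> B \<Longrightarrow> b \<lhd> a = 0" and "x \<in> span B"
  shows "x \<lhd> a = 0"
proof -
  interpret Vector_Spaces.linear "scale (\<lhd>)" "scale (\<lhd>)" "\<lambda>m. m \<lhd> a" by (rule linear_act)
  show ?thesis using eq_0_on_span[OF assms] .
qed

end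

lemma card_basis_eq_if_iso:
  assumes M: "free_algebra_module actM" "finite_dimensional actM"
    and N: "free_algebra_module actN" "finite_dimensional actN"
    and S: "submodule actM S" and T: "submodule actN T" and iso: "submodule_iso actM S actN T"
    and B: "\<not> module.dependent (scale actM) B" "module.span (scale actM) B = S"
    and C: "\<not> module.dependent (scale actN) C" "module.span (scale actN) C = T"
  shows "card B = card C"
proof -
  interpret M: free_algebra_module actM by fact
  interpret N: free_algebra_module actN by fact
  have "finite B" "finite C"
    using M.finite_independent[OF M(2) B(1)] N.finite_independent[OF N(2) C(1)] .
  then show ?thesis
    using card_basis_le_if_iso[OF M(1) N(1) S iso B(1) _ _ equalityD2[OF C(2)]]
      card_basis_le_if_iso[OF N(1) M(1) T submodule_iso_sym[OF S iso] C(1) _ _ equalityD2[OF B(2)]]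
      M.span_superset[of B] N.span_superset[of C] B(2) C(2)
    by (intro order_antisym) auto
qed

section \<open>Transport along embeddings, and the product module\<close>

lemma submodule_iso_image:
  assumes inj: "inj \<iota>" and add: "\<And>x y. \<iota> (x + y) = \<iota> x + \<iota> y" and act: "\<And>x a. \<iota> (actM x a) = actP (\<iota> x) a"
  shows "submodule_iso actM S actP (\<iota> ` S)"
  unfolding submodule_iso_def
  using inj add act by (intro exI[of _ \<iota>]) (auto simp: bij_betw_def intro: inj_on_subset)

text \<open>A submodule inside the image pulls back to a submodule of \<open>S\<close> and is
  recovered as the image of that preimage, so nothing new can lie between zero and the
  image.\<close>

lemma simple_submodule_image:
  fixes \<iota> :: "'m::ab_group_add \<Rightarrow> 'p::ab_group_add"
  assumes inj: "inj \<iota>" and add: "\<And>x y. \<iota> (x + y) = \<iota> x + \<iota> y" and act: "\<And>x a. \<iota> (actM x a) = actP (\<iota> x) a"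
    and S: "simple_submodule actM S"
  shows "simple_submodule actP (\<iota> ` S)"
proof -
  have \<iota>0: "\<iota> 0 = 0" using add[of 0 0] by simp
  have sub: "submodule actM S" using S by (simp add: simple_submodule_def)
  have "submodule actP (\<iota> ` S)"
    unfolding submodule_def
  proof (intro conjI ballI allI)
    show "0 \<in> \<iota> ` S" using sub \<iota>0 by (metis imageI submodule_def)
  qed (use sub in \<open>auto simp: submodule_def simp flip: add act\<close>)
  moreover have "\<iota> ` S \<noteq> {0}"
  proof
    assume "\<iota> ` S = {0}"
    then have "\<iota> ` S = \<iota> ` {0}" by (simp add: \<iota>0)
    then have "S = {0}" using inj by (simp only: inj_image_eq_iff)
    then show False using S by (simp add: simple_submodule_def)
  qed
  moreover have "T = {0} \<or> T = \<iota> ` S" if T: "submodule actP T" "T \<subseteq> \<iota> ` S" for T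
  proof -
    let ?T = "\<iota> -` T"
    have img: "T = \<iota> ` ?T" using T(2) by blast
    have "submodule actM ?T" using T(1) by (simp add: submodule_def add act \<iota>0)
    moreover have "?T \<subseteq> S" using T(2) inj by (auto dest: injD)
    ultimately have "?T = {0} \<or> ?T = S" using S by (simp add: simple_submodule_def)
    then show ?thesis using img \<iota>0 by (metis image_empty image_insert)
  qed
  ultimately show ?thesis unfolding simple_submodule_def by blast
qed

definition prod_act ::
  "('m::ab_group_add \<Rightarrow> 'r::ring_1 \<Rightarrow> 'm) \<Rightarrow> ('n::ab_group_add \<Rightarrow> 'r \<Rightarrow> 'n) \<Rightarrow> 'm \<times> 'n \<Rightarrow> 'r \<Rightarrow> 'm \<times> 'n" where
  "prod_act act act' p a = (act (fst p) a, act' (snd p) a)"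

lemma right_module_prod_act:
  assumes "right_module act" and "right_module act'"
  shows "right_module (prod_act act act')"
  using assms by (simp add: right_module_def prod_act_def prod_eq_iff)

section \<open>Multiplicities are read off from traces\<close>

text \<open>The separating element for the class of \<open>U\<close> has trace multiplicity times
  dimension on each module, and the dimension is the same positive number on both sides. The
  reference \<open>act0\<close> has its own type, so that the class can be named independently of
  both modules.\<close>

lemma multiplicity_eq:
  fixes actM :: "'m::ab_group_add \<Rightarrow> ('x, 'k::field) free_algebra \<Rightarrow> 'm"
    and actN :: "'n::ab_group_add \<Rightarrow> ('x, 'k) free_algebra \<Rightarrow> 'n"
    and act0 :: "'p::ab_group_add \<Rightarrow> ('x, 'k) free_algebra \<Rightarrow> 'p"
  assumes char0: "CHAR('k) = 0"
    and modM: "free_algebra_module actM" "finite_dimensional actM"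
    and modN: "free_algebra_module actN" "finite_dimensional actN"
    and F: "internal_direct_sum F" "\<And>S. S \<in> F \<Longrightarrow> simple_submodule actM S"
    and G: "internal_direct_sum G" "\<And>T. T \<in> G \<Longrightarrow> simple_submodule actN T"
    and chi: "char_fun actM = char_fun actN"
    and U: "submodule act0 U"
  shows "card {S \<in> F. submodule_iso actM S act0 U} = card {T \<in> G. submodule_iso actN T act0 U}"
proof -
  interpret M: free_algebra_module actM by fact
  interpret N: free_algebra_module actN by fact
  interpret P: right_module "prod_act actM actN"
    by (intro right_module_prod_act M.right_module_axioms N.right_module_axioms)
  let ?P = "prod_act actM actN" and ?i = "\<lambda>x::'m. (x, 0::'n)" and ?j = "\<lambda>y::'n. (0::'m, y)"
  have i: "inj ?i" "\<And>x y. ?i (x + y) = ?i x + ?i y" "\<And>x a. ?i (actM x a) = ?P (?i x) a"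
    by (auto simp: inj_def prod_act_def N.act_zero_left)
  have j: "inj ?j" "\<And>x y. ?j (x + y) = ?j x + ?j y" "\<And>x a. ?j (actN x a) = ?P (?j x) a"
    by (auto simp: inj_def prod_act_def M.act_zero_left)
  note simple_i = simple_submodule_image[of ?i actM ?P, OF i] and iso_i = submodule_iso_image[of ?i actM ?P, OF i]
  note simple_j = simple_submodule_image[of ?j actN ?P, OF j] and iso_j = submodule_iso_image[of ?j actN ?P, OF j]
  have subF: "submodule actM S" if "S \<in> F" for S using F(2)[OF that] by (simp add: simple_submodule_def)
  have subG: "submodule actN T" if "T \<in> G" for T using G(2)[OF that] by (simp add: simple_submodule_def)
  obtain B where B: "\<And>S. S \<in> F \<Longrightarrow> M.independent (B S)" "\<And>S. S \<in> F \<Longrightarrow> M.span (B S) = S"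
    using M.subspace_basis[OF M.submodule_imp_subspace[OF subF]] by metis
  obtain C where C: "\<And>T. T \<in> G \<Longrightarrow> N.independent (C T)" "\<And>T. T \<in> G \<Longrightarrow> N.span (C T) = T"
    using N.subspace_basis[OF N.submodule_imp_subspace[OF subG]] by metis
  have B_sub: "B S \<subseteq> S" if "S \<in> F" for S using M.span_superset[of "B S"] B(2)[OF that] by simp
  have C_sub: "C T \<subseteq> T" if "T \<in> G" for T using N.span_superset[of "C T"] C(2)[OF that] by simp
  have finF: "finite F" by (rule M.finite_summands[OF modM(2) F])
  have finG: "finite G" by (rule N.finite_summands[OF modN(2) G])
  have finB: "finite (B S)" if "S \<in> F" for S using M.finite_independent[OF modM(2) B(1)[OF that]] .
  have finC: "finite (C T)" if "T \<in> G" for T using N.finite_independent[OF modN(2) C(1)[OF that]] .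
  define F1 where "F1 = {S \<in> F. submodule_iso actM S act0 U}"
  define G1 where "G1 = {T \<in> G. submodule_iso actN T act0 U}"
  have F1: "F1 \<subseteq> F" and G1: "G1 \<subseteq> G" by (auto simp: F1_def G1_def)

  \<comment> \<open>\<open>X\<close> collects the embedded summands isomorphic to \<open>U\<close>,
    \<open>Y\<close> all the others. \<open>V\<close> and \<open>W\<close> consist of their basis
    vectors: fixing \<open>V\<close> suffices to control the trace, and whatever kills
    \<open>W\<close> kills the spans and thus \<open>\<Union>Y\<close>.\<close>
  define X where "X = (`) ?i ` F1 \<union> (`) ?j ` G1"
  define Y where "Y = (`) ?i ` (F - F1) \<union> (`) ?j ` (G - G1)"
  define V where "V = ?i ` \<Union>(B ` F1) \<union> ?j ` \<Union>(C ` G1)"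
  define W where "W = ?i ` \<Union>(B ` (F - F1)) \<union> ?j ` \<Union>(C ` (G - G1))"
  have X_simple: "simple_submodule ?P S" if "S \<in> X" for S
    using that F(2) G(2) F1 G1 unfolding X_def by (blast intro: simple_i simple_j)
  have Y_simple: "simple_submodule ?P T" if "T \<in> Y" for T
    using that F(2) G(2) unfolding Y_def by (blast intro: simple_i simple_j)
  have X_iso: "submodule_iso ?P S act0 U" if "S \<in> X" for S
    using that subF subG F1 G1 submodule_iso_trans[OF submodule_iso_sym[OF _ iso_i]]
      submodule_iso_trans[OF submodule_iso_sym[OF _ iso_j]]
    unfolding X_def F1_def G1_def by blast
  have Y_not_iso: "\<not> submodule_iso ?P T act0 U" if "T \<in> Y" for T
    using that submodule_iso_trans[OF iso_i] submodule_iso_trans[OF iso_j]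
    unfolding Y_def F1_def G1_def by blast
  have "\<exists>e. (\<forall>v\<in>V. ?P v e = v) \<and> (\<forall>x\<in>\<Union>Y. ?P x e = 0)"
  proof (rule P.separating_element[OF X_simple Y_simple])
    show "\<not> submodule_iso ?P T ?P S" if "S \<in> X" "T \<in> Y" for S T
      using X_iso[OF that(1)] Y_not_iso[OF that(2)] submodule_iso_trans by blast
    show "finite V" "finite W"
      unfolding V_def W_def
      using finF finG finite_subset[OF F1 finF] finite_subset[OF G1 finG] F1 G1 finB finC
      by (intro finite_UnI finite_imageI finite_UN_I finite_Diff; blast)+
    have "\<Union>(B ` F1) \<subseteq> \<Union>F1" "\<Union>(C ` G1) \<subseteq> \<Union>G1" using F1 G1 B_sub C_sub by blast+
    then show "V \<subseteq> \<Union>X"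
      unfolding V_def X_def Union_Un_distrib image_Union[symmetric] by (intro Un_mono image_mono)
    have "\<Union>(B ` (F - F1)) \<subseteq> \<Union>(F - F1)" "\<Union>(C ` (G - G1)) \<subseteq> \<Union>(G - G1)" using B_sub C_sub by blast+
    then show "W \<subseteq> \<Union>Y"
      unfolding W_def Y_def Union_Un_distrib image_Union[symmetric] by (intro Un_mono image_mono)
    fix a x assume a: "\<And>w. w \<in> W \<Longrightarrow> ?P w a = 0" and x: "x \<in> \<Union>Y"
    have aB: "actM b a = 0" if "b \<in> B S" "S \<in> F - F1" for b S
      using a[of "?i b"] that by (auto simp: W_def prod_act_def zero_prod_def)
    have aC: "actN b a = 0" if "b \<in> C T" "T \<in> G - G1" for b T
      using a[of "?j b"] that by (auto simp: W_def prod_act_def zero_prod_def)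
    from x consider S y where "S \<in> F - F1" "y \<in> S" "x = ?i y" | T y where "T \<in> G - G1" "y \<in> T" "x = ?j y"
      unfolding Y_def by blast
    then show "?P x a = 0"
    proof cases
      case 1
      then have "actM y a = 0" using M.act_zero_on_span[of "B S" a y] aB B(2)[of S] by blast
      then show ?thesis using 1 by (simp add: prod_act_def zero_prod_def N.act_zero_left)
    next
      case 2
      then have "actN y a = 0" using N.act_zero_on_span[of "C T" a y] aC C(2)[of T] by blast
      then show ?thesis using 2 by (simp add: prod_act_def zero_prod_def M.act_zero_left)
    qed
  qed
  then obtain e where e1: "\<And>v. v \<in> V \<Longrightarrow> ?P v e = v" and e0: "\<And>x. x \<in> \<Union>Y \<Longrightarrow> ?P x e = 0" by blast

  have "endo_trace actM (alpha actM e) = of_nat (\<Sum>S\<in>F1. card (B S))"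
  proof (rule M.endo_trace_projection[OF modM(2) F B F1])
    show "actM b e = b" if "b \<in> \<Union>(B ` F1)" for b
      using e1[of "?i b"] that unfolding V_def prod_act_def by simp
    show "actM b e = 0" if "b \<in> \<Union>(B ` (F - F1))" for b
    proof -
      have "?i b \<in> \<Union>Y" unfolding Y_def using that B_sub by blast
      from e0[OF this] show ?thesis by (simp add: prod_act_def zero_prod_def)
    qed
  qed
  moreover have "endo_trace actN (alpha actN e) = of_nat (\<Sum>T\<in>G1. card (C T))"
  proof (rule N.endo_trace_projection[OF modN(2) G C G1])
    show "actN b e = b" if "b \<in> \<Union>(C ` G1)" for b
      using e1[of "?j b"] that unfolding V_def prod_act_def by simp
    show "actN b e = 0" if "b \<in> \<Union>(C ` (G - G1))" for b
    proof -
      have "?j b \<in> \<Union>Y" unfolding Y_def using that C_sub by blast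
      from e0[OF this] show ?thesis by (simp add: prod_act_def zero_prod_def)
    qed
  qed
  \<comment> \<open>Here the hypothesis enters: both traces are the same linear combination of
    coefficients of the characteristic functions.\<close>
  moreover have "endo_trace actM (alpha actM e) = endo_trace actN (alpha actN e)"
    by (simp add: M.endo_trace_eq_char_fun_sum[OF modM(2)] N.endo_trace_eq_char_fun_sum[OF modN(2)] chi)
  ultimately have "(of_nat (\<Sum>S\<in>F1. card (B S)) :: 'k) = of_nat (\<Sum>T\<in>G1. card (C T))" by simp
  then have sums: "(\<Sum>S\<in>F1. card (B S)) = (\<Sum>T\<in>G1. card (C T))"
    by (rule of_nat_inject_CHAR_0[OF char0])

  \<comment> \<open>\<open>d\<close> is the dimension of any summand in the class, taken from
    whichever of \<open>F1\<close> and \<open>G1\<close> is nonempty. If both are empty, any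
    positive number will do.\<close>
  have "\<exists>d>0. (\<forall>S\<in>F1. card (B S) = d) \<and> (\<forall>T\<in>G1. card (C T) = d)"
  proof (cases "F1 = {}")
    case False
    then obtain S0 where S0: "S0 \<in> F" "submodule_iso actM S0 act0 U" unfolding F1_def by blast
    have "card (B S) = card (B S0)" if "S \<in> F1" for S
      by (rule card_basis_eq_if_iso[OF modM modM _ _ submodule_iso_common])
        (use that S0 subF B F1_def in auto)
    moreover have "card (C T) = card (B S0)" if "T \<in> G1" for T
      by (rule card_basis_eq_if_iso[OF modN modM _ _ submodule_iso_common])
        (use that S0 subF subG B C G1_def in auto)
    moreover have "B S0 \<noteq> {}" using B(2)[OF S0(1)] F(2)[OF S0(1)] by (auto simp: simple_submodule_def)
    then have "card (B S0) > 0" using finB[OF S0(1)] by (simp add: card_gt_0_iff)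
    ultimately show ?thesis by blast
  next
    case F1_empty: True
    show ?thesis
    proof (cases "G1 = {}")
      case False
      then obtain T0 where T0: "T0 \<in> G" "submodule_iso actN T0 act0 U" unfolding G1_def by blast
      have "card (C T) = card (C T0)" if "T \<in> G1" for T
        by (rule card_basis_eq_if_iso[OF modN modN _ _ submodule_iso_common])
          (use that T0 subG C G1_def in auto)
      moreover have "C T0 \<noteq> {}" using C(2)[OF T0(1)] G(2)[OF T0(1)] by (auto simp: simple_submodule_def)
      then have "card (C T0) > 0" using finC[OF T0(1)] by (simp add: card_gt_0_iff)
      ultimately show ?thesis using F1_empty by blast
    qed (use F1_empty in auto)
  qed
  then obtain d where d: "d > 0" "\<And>S. S \<in> F1 \<Longrightarrow> card (B S) = d" "\<And>T. T \<in> G1 \<Longrightarrow> card (C T) = d"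
    by blast
  have "card F1 * d = card G1 * d" using sums d(2,3) by simp
  then show ?thesis using d(1) by (simp add: F1_def G1_def)
qed

section \<open>Assembling an isomorphism from matched summands\<close>

lemma internal_direct_sum_finite_components:
  assumes F: "internal_direct_sum F" "finite F" and F0: "\<And>S. S \<in> F \<Longrightarrow> 0 \<in> S"
  shows "\<exists>f. (\<forall>S\<in>F. f S \<in> S) \<and> m = (\<Sum>S\<in>F. f S)"
proof -
  obtain F' f where f: "finite F'" "F' \<subseteq> F" "\<And>S. S \<in> F' \<Longrightarrow> f S \<in> S" "m = (\<Sum>S\<in>F'. f S)"
    using internal_direct_sum_components[OF F(1)] by blast
  have "(\<Sum>S\<in>F. if S \<in> F' then f S else 0) = m"
    unfolding f(4) using f(2) F(2) by (intro sum.mono_neutral_cong_right) auto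
  then show ?thesis
    using f F0 by (intro exI[of _ "\<lambda>S. if S \<in> F' then f S else 0"]) auto
qed

text \<open>The isomorphism applies \<open>\<phi> S\<close> to each component and adds up.
  Uniqueness of components in \<open>F\<close> makes it additive and equivariant, directness of
  \<open>G\<close> makes it injective, and existence of components in \<open>G\<close> makes it
  surjective.\<close>

lemma isomorphic_direct_sums:
  assumes "right_module actM" and "right_module actN"
    and F: "internal_direct_sum F" "finite F" "\<And>S. S \<in> F \<Longrightarrow> submodule actM S"
    and G: "internal_direct_sum G" "\<And>T. T \<in> G \<Longrightarrow> submodule actN T"
    and \<sigma>: "bij_betw \<sigma> F G" and iso: "\<And>S. S \<in> F \<Longrightarrow> submodule_iso actM S actN (\<sigma> S)"
  shows "isomorphic actM actN"
proof -
  interpret M: right_module actM by fact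
  interpret N: right_module actN by fact
  have "\<forall>S\<in>F. \<exists>\<phi>. bij_betw \<phi> S (\<sigma> S) \<and> (\<forall>x\<in>S. \<forall>y\<in>S. \<phi> (x + y) = \<phi> x + \<phi> y) \<and>
      (\<forall>x\<in>S. \<forall>a. \<phi> (actM x a) = actN (\<phi> x) a)"
    using iso unfolding submodule_iso_def by blast
  then obtain \<phi> where "\<forall>S\<in>F. bij_betw (\<phi> S) S (\<sigma> S) \<and>
      (\<forall>x\<in>S. \<forall>y\<in>S. \<phi> S (x + y) = \<phi> S x + \<phi> S y) \<and>
      (\<forall>x\<in>S. \<forall>a. \<phi> S (actM x a) = actN (\<phi> S x) a)"
    by (rule bchoice[THEN exE])
  then have \<phi>_bij: "\<And>S. S \<in> F \<Longrightarrow> bij_betw (\<phi> S) S (\<sigma> S)"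
    and \<phi>_add: "\<And>S x y. S \<in> F \<Longrightarrow> x \<in> S \<Longrightarrow> y \<in> S \<Longrightarrow> \<phi> S (x + y) = \<phi> S x + \<phi> S y"
    and \<phi>_act: "\<And>S x a. S \<in> F \<Longrightarrow> x \<in> S \<Longrightarrow> \<phi> S (actM x a) = actN (\<phi> S x) a"
    by simp_all
  have F0: "0 \<in> S" if "S \<in> F" for S using M.submodule_0[OF F(3)[OF that]] .
  have G0: "0 \<in> T" if "T \<in> G" for T using N.submodule_0[OF G(2)[OF that]] .
  have finG: "finite G" using \<sigma> F(2) by (simp add: bij_betw_finite)
  have \<phi>0: "\<phi> S 0 = 0" if "S \<in> F" for S using \<phi>_add[OF that F0 F0] that by simp
  \<comment> \<open>The chosen family is arbitrary outside \<open>F\<close>;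
    \<open>\<pi>_eqI\<close> therefore determines components only at members of
    \<open>F\<close>.\<close>
  define \<pi> where "\<pi> m = (SOME f. (\<forall>S\<in>F. f S \<in> S) \<and> m = (\<Sum>S\<in>F. f S))" for m
  have \<pi>: "(\<forall>S\<in>F. \<pi> m S \<in> S) \<and> m = (\<Sum>S\<in>F. \<pi> m S)" for m
    unfolding \<pi>_def using internal_direct_sum_finite_components[OF F(1,2) F0] by (rule someI_ex)
  have \<pi>_eqI: "\<pi> m S = f S" if f: "\<And>S. S \<in> F \<Longrightarrow> f S \<in> S" "m = (\<Sum>S\<in>F. f S)" and S: "S \<in> F" for m f S
  proof -
    have "(\<Sum>S\<in>F. \<pi> m S - f S) = 0" using \<pi>[of m] f(2) by (simp add: sum_subtractf)
    moreover have "\<pi> m S - f S \<in> S" if "S \<in> F" for S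
      using M.submodule_diff[OF F(3)[OF that]] \<pi>[of m] f(1) that by blast
    ultimately have "\<pi> m S - f S = 0"
      using internal_direct_sum_zeroD[OF F(1) F0 F(2), of "\<lambda>S. \<pi> m S - f S"] S by blast
    then show ?thesis by simp
  qed
  define \<Phi> where "\<Phi> m = (\<Sum>S\<in>F. \<phi> S (\<pi> m S))" for m
  have add: "\<Phi> (m + n) = \<Phi> m + \<Phi> n" for m n
  proof -
    have "\<pi> (m + n) S = \<pi> m S + \<pi> n S" if "S \<in> F" for S
    proof (rule \<pi>_eqI[OF _ _ that])
      show "\<pi> m S + \<pi> n S \<in> S" if "S \<in> F" for S
        using M.submodule_add[OF F(3)[OF that]] \<pi> that by blast
      show "m + n = (\<Sum>S\<in>F. \<pi> m S + \<pi> n S)"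
        using \<pi>[of m] \<pi>[of n] by (simp add: sum.distrib)
    qed
    then show ?thesis using \<pi> by (simp add: \<Phi>_def \<phi>_add sum.distrib)
  qed
  have act: "\<Phi> (actM m a) = actN (\<Phi> m) a" for m a
  proof -
    have "\<pi> (actM m a) S = actM (\<pi> m S) a" if "S \<in> F" for S
    proof (rule \<pi>_eqI[OF _ _ that])
      show "actM (\<pi> m S) a \<in> S" if "S \<in> F" for S
        using M.submodule_act[OF F(3)[OF that]] \<pi> that by blast
      show "actM m a = (\<Sum>S\<in>F. actM (\<pi> m S) a)"
        using \<pi>[of m] by (simp flip: M.act_sum_left)
    qed
    then show ?thesis using \<pi> by (simp add: \<Phi>_def \<phi>_act N.act_sum_left)
  qed
  have inj0: "m = 0" if m: "\<Phi> m = 0" for m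
  proof -
    let ?\<tau> = "inv_into F \<sigma>"
    \<comment> \<open>The components of \<open>\<Phi> m\<close>, reindexed by the summands in
      \<open>G\<close> so that directness of \<open>G\<close> can be applied to their sum.\<close>
    define g where "g T = \<phi> (?\<tau> T) (\<pi> m (?\<tau> T))" for T
    have \<tau>: "?\<tau> (\<sigma> S) = S" if "S \<in> F" for S
      using \<sigma> that by (meson bij_betw_inv_into_left)
    have "(\<Sum>T\<in>G. g T) = (\<Sum>S\<in>F. g (\<sigma> S))"
      by (rule sum.reindex_bij_betw[OF \<sigma>, symmetric])
    also have "\<dots> = 0" using m by (simp add: g_def \<tau> \<Phi>_def)
    finally have "(\<Sum>T\<in>G. g T) = 0" .
    moreover have "g T \<in> T" if T: "T \<in> G" for T
    proof -
      obtain S where S: "S \<in> F" "T = \<sigma> S" using T \<sigma> by (auto simp: bij_betw_def)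
      then have "g T = \<phi> S (\<pi> m S)" by (simp add: g_def \<tau>)
      then show ?thesis using bij_betwE[OF \<phi>_bij[OF S(1)]] \<pi> S by auto
    qed
    ultimately have gz: "g T = 0" if "T \<in> G" for T
      using internal_direct_sum_zeroD[OF G(1) G0 finG, of g T] that by blast
    have "\<pi> m S = 0" if S: "S \<in> F" for S
    proof -
      have "\<phi> S (\<pi> m S) = \<phi> S 0"
        using gz[of "\<sigma> S"] bij_betwE[OF \<sigma>] S by (simp add: g_def \<tau> \<phi>0)
      then show ?thesis
        using bij_betw_imp_inj_on[OF \<phi>_bij[OF S]] \<pi> F0 S by (auto dest: inj_onD)
    qed
    then show ?thesis using \<pi>[of m] by simp
  qed
  have "inj \<Phi>"
  proof (rule injI)
    fix m n assume mn: "\<Phi> m = \<Phi> n"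
    have "\<Phi> (m - n) = 0" using add[of "m - n" n] mn by simp
    from inj0[OF this] show "m = n" by simp
  qed
  moreover have "\<exists>m. \<Phi> m = n" for n
  proof -
    obtain g where g: "\<forall>T\<in>G. g T \<in> T" "n = (\<Sum>T\<in>G. g T)"
      using internal_direct_sum_finite_components[OF G(1) finG G0] by blast
    \<comment> \<open>Each component of \<open>n\<close> is pulled back through the isomorphism onto
      its summand; the sum of these is the preimage.\<close>
    define f where "f S = inv_into S (\<phi> S) (g (\<sigma> S))" for S
    have f: "f S \<in> S" "\<phi> S (f S) = g (\<sigma> S)" if S: "S \<in> F" for S
    proof -
      have "g (\<sigma> S) \<in> \<phi> S ` S"
        using g(1) bij_betwE[OF \<sigma>] S bij_betw_imp_surj_on[OF \<phi>_bij[OF S]] by blast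
      then show "f S \<in> S" "\<phi> S (f S) = g (\<sigma> S)"
        unfolding f_def by (rule inv_into_into, rule f_inv_into_f)
    qed
    have "\<Phi> (\<Sum>S\<in>F. f S) = (\<Sum>S\<in>F. g (\<sigma> S))"
      unfolding \<Phi>_def using \<pi>_eqI[OF f(1) refl] f(2) by (intro sum.cong) auto
    also have "\<dots> = n" unfolding g(2) by (rule sum.reindex_bij_betw[OF \<sigma>])
    finally show ?thesis ..
  qed
  then have "surj \<Phi>" by (metis surjI)
  ultimately show ?thesis
    unfolding isomorphic_def bij_def using add act by blast
qed

text \<open>Bijections between corresponding fibres are glued. Different fibres cannot collide,
  because \<open>l\<close> recovers from an image the fibre it came from. With isomorphism classes
  as fibres, equal multiplicities become a matching of summands.\<close>

lemma bij_betw_equal_fibres: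
  assumes "finite F" and "finite G"
    and card: "\<And>c. card {x \<in> F. k x = c} = card {y \<in> G. l y = c}"
  shows "\<exists>\<sigma>. bij_betw \<sigma> F G \<and> (\<forall>x\<in>F. l (\<sigma> x) = k x)"
proof -
  have "\<exists>h. bij_betw h {x \<in> F. k x = c} {y \<in> G. l y = c}" for c
    using assms by (intro finite_same_card_bij) auto
  then obtain h where h: "\<And>c. bij_betw (h c) {x \<in> F. k x = c} {y \<in> G. l y = c}" by metis
  define \<sigma> where "\<sigma> x = h (k x) x" for x
  have \<sigma>: "\<sigma> x \<in> G" "l (\<sigma> x) = k x" if "x \<in> F" for x
    using bij_betwE[OF h[of "k x"]] that by (auto simp: \<sigma>_def)
  have "inj_on \<sigma> F"
  proof (rule inj_onI)
    fix x y assume xy: "x \<in> F" "y \<in> F" "\<sigma> x = \<sigma> y"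
    then have "k x = k y" using \<sigma> by metis
    then show "x = y"
      using xy bij_betw_imp_inj_on[OF h[of "k x"]] by (auto simp: \<sigma>_def dest: inj_onD)
  qed
  moreover have "y \<in> \<sigma> ` F" if "y \<in> G" for y
  proof -
    have "y \<in> h (l y) ` {x \<in> F. k x = l y}"
      using bij_betw_imp_surj_on[OF h[of "l y"]] that by auto
    then obtain x where "x \<in> F" "k x = l y" "y = h (l y) x" by blast
    then have "y = \<sigma> x" by (simp only: \<sigma>_def)
    then show ?thesis using \<open>x \<in> F\<close> by (rule image_eqI)
  qed
  ultimately have "bij_betw \<sigma> F G" using \<sigma> by (auto simp: bij_betw_def)
  then show ?thesis using \<sigma> by blast
qed

theorem theorem2p12:
  fixes actM :: "'m::ab_group_add \<Rightarrow> ('x::finite, 'k::alg_closed_field) free_algebra \<Rightarrow> 'm"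
    and actN :: "'n::ab_group_add \<Rightarrow> ('x, 'k) free_algebra \<Rightarrow> 'n"
  assumes "CHAR('k) = 0"
    and "right_module actM" and "finite_dimensional actM" and "semisimple actM"
    and "right_module actN" and "finite_dimensional actN" and "semisimple actN"
  shows "isomorphic actM actN \<longleftrightarrow> char_fun actM = char_fun actN"
proof
  interpret M: right_module actM by fact
  interpret N: right_module actN by fact
  have M: "free_algebra_module actM" and N: "free_algebra_module actN" ..
  show "char_fun actM = char_fun actN" if "isomorphic actM actN"
    using char_fun_eq_if_isomorphic[OF M assms(3) N assms(6) that] .
  assume chi: "char_fun actM = char_fun actN"
  obtain F where F: "internal_direct_sum F" "\<And>S. S \<in> F \<Longrightarrow> simple_submodule actM S"
    using assms(4) unfolding semisimple_def by blast
  obtain G where G: "internal_direct_sum G" "\<And>T. T \<in> G \<Longrightarrow> simple_submodule actN T"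
    using assms(7) unfolding semisimple_def by blast
  have subF: "submodule actM S" if "S \<in> F" for S using F(2)[OF that] by (simp add: simple_submodule_def)
  have subG: "submodule actN T" if "T \<in> G" for T using G(2)[OF that] by (simp add: simple_submodule_def)
  have finF: "finite F" by (rule free_algebra_module.finite_summands[OF M assms(3) F])
  have finG: "finite G" by (rule free_algebra_module.finite_summands[OF N assms(6) G])

  let ?P = "prod_act actM actN"
  interpret P: right_module ?P
    by (intro right_module_prod_act assms)
  have i: "inj (\<lambda>x::'m. (x, 0::'n))" "\<And>x y. (x + y, 0) = (x, 0::'n) + (y, 0)"
      "\<And>x a. (actM x a, 0) = ?P (x, 0) a"
    by (auto simp: inj_def prod_act_def N.act_zero_left)
  have j: "inj (\<lambda>y::'n. (0::'m, y))" "\<And>x y. (0, x + y) = (0::'m, x) + (0, y)"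
      "\<And>x a. (0, actN x a) = ?P (0, x) a"
    by (auto simp: inj_def prod_act_def M.act_zero_left)
  note iM = submodule_iso_image[of "\<lambda>x. (x, 0)" actM ?P, OF i]
  note iN = submodule_iso_image[of "\<lambda>y. (0, y)" actN ?P, OF j]
  have subP_M: "submodule ?P ((\<lambda>x. (x, 0)) ` S)" if "simple_submodule actM S" for S
    using simple_submodule_image[of "\<lambda>x. (x, 0)" actM ?P, OF i that] by (simp add: simple_submodule_def)
  have subP_N: "submodule ?P ((\<lambda>y. (0, y)) ` T)" if "simple_submodule actN T" for T
    using simple_submodule_image[of "\<lambda>y. (0, y)" actN ?P, OF j that] by (simp add: simple_submodule_def)
  \<comment> \<open>Classes are labelled by sets of submodules of the product, which contains a copy
    of every summand of either module. The fibres of \<open>k\<close> and \<open>l\<close> over such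
    a label have the multiplicities as their sizes.\<close>
  define cl where "cl U = {U'. submodule ?P U' \<and> submodule_iso ?P U ?P U'}" for U
  define k where "k S = {U'. submodule ?P U' \<and> submodule_iso actM S ?P U'}" for S
  define l where "l T = {U'. submodule ?P U' \<and> submodule_iso actN T ?P U'}" for T
  have k_eq: "k S = cl U \<longleftrightarrow> submodule_iso actM S ?P U" if "S \<in> F" "submodule ?P U" for S U
    unfolding k_def cl_def using iso_class_eq_iff[OF subF] that by blast
  have l_eq: "l T = cl U \<longleftrightarrow> submodule_iso actN T ?P U" if "T \<in> G" "submodule ?P U" for T U
    unfolding l_def cl_def using iso_class_eq_iff[OF subG] that by blast
  have k_ex: "\<exists>U. submodule ?P U \<and> k S = cl U" if "S \<in> F" for S
    using k_eq[OF that] iM subP_M[OF F(2)[OF that]] by blast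
  have l_ex: "\<exists>U. submodule ?P U \<and> l T = cl U" if "T \<in> G" for T
    using l_eq[OF that] iN subP_N[OF G(2)[OF that]] by blast
  have "card {S \<in> F. k S = c} = card {T \<in> G. l T = c}" for c
  proof (cases "\<exists>U. submodule ?P U \<and> c = cl U")
    case True
    then obtain U where U: "submodule ?P U" "c = cl U" by blast
    have "{S \<in> F. k S = c} = {S \<in> F. submodule_iso actM S ?P U}"
      using k_eq U by blast
    moreover have "{T \<in> G. l T = c} = {T \<in> G. submodule_iso actN T ?P U}"
      using l_eq U by blast
    ultimately show ?thesis
      using multiplicity_eq[OF assms(1) M assms(3) N assms(6) F G chi U(1)] by simp
  next
    case False
    \<comment> \<open>Every summand is labelled by the class of its copy in the product, so a value
      \<open>c\<close> that is no class has empty fibres on both sides.\<close>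
    then have "{S \<in> F. k S = c} = {}" "{T \<in> G. l T = c} = {}" using k_ex l_ex by blast+
    then show ?thesis by (simp only: card.empty)
  qed
  then obtain \<sigma> where \<sigma>: "bij_betw \<sigma> F G" "\<forall>S\<in>F. l (\<sigma> S) = k S"
    using bij_betw_equal_fibres[OF finF finG] by blast
  have iso: "submodule_iso actM S actN (\<sigma> S)" if S: "S \<in> F" for S
  proof -
    have \<sigma>S: "\<sigma> S \<in> G" using bij_betwE[OF \<sigma>(1)] S by blast
    \<comment> \<open>\<open>U\<close> links the two summands: it is isomorphic to \<open>S\<close>,
      and the equality of labels makes it isomorphic to \<open>\<sigma> S\<close> too.\<close>
    obtain U where U: "submodule ?P U" "k S = cl U" using k_ex[OF S] by blast
    moreover have "l (\<sigma> S) = cl U" using \<sigma>(2) S U(2) by simp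
    ultimately show ?thesis
      using k_eq[OF S U(1)] l_eq[OF \<sigma>S U(1)] submodule_iso_common subG[OF \<sigma>S] by blast
  qed
  show "isomorphic actM actN"
    by (rule isomorphic_direct_sums[OF assms(2,5) F(1) finF subF G(1) subG \<sigma>(1) iso])
qed

end
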